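(* Let $f(z)=\sum_{n=0}^\infty a_nz^n$ be a transcendental entire function of logarithmic order $0$. Then its double logarithmic order is $$\rho^{[2]}_f=\limsup_{n\to\infty}\frac{\log n}{\log\log\log\left(\frac{1}{\sqrt[n]{|a_n|}}\right)},$$ and if $0<\rho^{[2]}_f<\infty$, then its double logarithmic type is $$\tau^{[2]}_f=\limsup_{n\to\infty}\frac{n}{\left(\log\log\frac{1}{\sqrt[n]{|a_n|}}\right)^{\rho^{[2]}_f}}.$$
   Context: For an unbounded continuous $f:\mathbb C\to\mathbb C$ let $M_f(r)=\max_{|z|\le r}|f(z)|$. The logarithmic order is $\rho^{[1]}_f=\inf\{a>0\mid M_f(r)\le r^{(\log r)^a}\text{ for all sufficiently large }r\}$. The double logarithmic order is $\rho^{[2]}_f=\inf\{a>0\mid M_f(r)\le r^{(\log\log r)^a}\text{ for all sufficiently large }r\}\in[0,\infty]$, with value $\infty$ if no such $a$ exists. If $0<\rho^{[2]}_f<\infty$, the double logarithmic type is $\tau^{[2]}_f=\inf\{c>0\mid M_f(r)\le r^{c(\log\log r)^{\rho^{[2]}_f}}\text{ for all sufficiently large }r\}$ ($\inf\emptyset=\infty$). In the limsup formulas, terms with $a_n=0$ are interpreted as $0$ (i.e. $1/\sqrt[n]{0}=\infty$). *)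

theory Defs
  imports "HOL-Complex_Analysis.Complex_Analysis"
begin

text \<open>
  The growth notions below are meant for unbounded continuous functions. For continuous \<open>f\<close> and
  \<open>r \<ge> 0\<close> the supremum in \<open>max_modulus\<close> is attained by compactness, so it is the maximum of
  \<open>\<bar>f z\<bar>\<close> over the closed disc.
\<close>

definition max_modulus :: "(complex \<Rightarrow> complex) \<Rightarrow> real \<Rightarrow> real" where
  "max_modulus f r = (SUP z\<in>cball 0 r. norm (f z))"

text \<open>
  The infima are taken in the extended reals, so that the infimum of the empty set is \<open>\<infinity>\<close>.
\<close>

definition log_order :: "(complex \<Rightarrow> complex) \<Rightarrow> ereal" where
  "log_order f = Inf (ereal ` {a. a > 0 \<and>
     (\<forall>\<^sub>F r in at_top. max_modulus f r \<le> r powr (ln r powr a))})"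

definition double_log_order :: "(complex \<Rightarrow> complex) \<Rightarrow> ereal" where
  "double_log_order f = Inf (ereal ` {a. a > 0 \<and>
     (\<forall>\<^sub>F r in at_top. max_modulus f r \<le> r powr (ln (ln r) powr a))})"

text \<open>
  The double logarithmic type is only meaningful if the double logarithmic order is positive and
  finite, in which case \<open>real_of_ereal\<close> is the exact conversion.
\<close>

definition double_log_type :: "(complex \<Rightarrow> complex) \<Rightarrow> ereal" where
  "double_log_type f = Inf (ereal ` {c. c > 0 \<and>
     (\<forall>\<^sub>F r in at_top. max_modulus f r
        \<le> r powr (c * ln (ln r) powr real_of_ereal (double_log_order f)))})"

definition transcendental_entire :: "(complex \<Rightarrow> complex) \<Rightarrow> bool" where
  "transcendental_entire f \<longleftrightarrow> f holomorphic_on UNIV \<and> \<not> (\<exists>p. \<forall>z. f z = poly p z)"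

text \<open>
  In the following two sequences a vanishing coefficient contributes \<open>0\<close>, according to the
  convention \<open>1 / root n 0 = \<infinity>\<close>. For an entire function the numbers \<open>1 / root n \<bar>a n\<bar>\<close> with
  \<open>a n \<noteq> 0\<close> tend to infinity, so only finitely many terms can involve a logarithm of a
  nonpositive number or a division by zero; these do not affect the limit superior.
\<close>

definition double_log_order_term :: "(nat \<Rightarrow> complex) \<Rightarrow> nat \<Rightarrow> real" where
  "double_log_order_term a n =
     (if a n = 0 then 0 else ln (real n) / ln (ln (ln (1 / root n (norm (a n))))))"

definition double_log_type_term :: "real \<Rightarrow> (nat \<Rightarrow> complex) \<Rightarrow> nat \<Rightarrow> real" where
  "double_log_type_term \<rho> a n =
     (if a n = 0 then 0 else real n / ln (ln (1 / root n (norm (a n)))) powr \<rho>)"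

end

theory Submission imports Defs "HOL-Real_Asymp.Real_Asymp" begin

text \<open>
  Let \<open>b\<^sub>n = ln (1 / root n \<bar>a\<^sub>n\<bar>)\<close>. The growth bound \<open>M(r) \<le> r powr (c (ln ln r) powr \<rho>)\<close>
  is, up to an arbitrarily small increase of \<open>c\<close>, equivalent to the coefficient bound
  \<open>n \<le> c (ln b\<^sub>n) powr \<rho>\<close> for large \<open>n\<close> with \<open>a\<^sub>n \<noteq> 0\<close>. In one direction, Cauchy's inequality is
  applied on the circle with \<open>c\<^sub>1 (ln ln r) powr \<rho> = n\<close>, where \<open>c\<^sub>1\<close> is slightly larger than \<open>c\<close>.
  In the other, the terms \<open>\<bar>a\<^sub>n\<bar> (2 r)^n\<close> with \<open>n > c\<^sub>1 (ln ln r) powr \<rho>\<close> are at most \<open>1\<close>, and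
  each of the others is at most a constant times \<open>(2 r) powr (c\<^sub>1 (ln ln r) powr \<rho>)\<close>.
  The formula for the type follows at once, and the one for the order because changing \<open>c\<close> alters
  the admissible exponents \<open>\<rho>\<close> only by an arbitrarily small amount.
\<close>

definition log_decay :: "(nat \<Rightarrow> complex) \<Rightarrow> nat \<Rightarrow> real" where
  "log_decay a n = ln (1 / root n (norm (a n)))"

text \<open>Both parameters stay free: the order uses \<open>c = 1\<close> with varying \<rho>, the
  type uses the order as \<rho> with varying \<open>c\<close>.\<close>

definition double_log_growth :: "(complex \<Rightarrow> complex) \<Rightarrow> real \<Rightarrow> real \<Rightarrow> bool" where
  "double_log_growth f c \<rho> \<longleftrightarrow>
     (\<forall>\<^sub>F r in at_top. max_modulus f r \<le> r powr (c * ln (ln r) powr \<rho>))"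

text \<open>Indices with \<open>a n = 0\<close> are exempt: there the intended decay is infinite,
  while \<open>log_decay a n\<close> is a mere default value.\<close>

definition double_log_decay :: "(nat \<Rightarrow> complex) \<Rightarrow> real \<Rightarrow> real \<Rightarrow> bool" where
  "double_log_decay a c \<rho> \<longleftrightarrow>
     (\<forall>\<^sub>F n in sequentially. a n \<noteq> 0 \<longrightarrow> real n \<le> c * ln (log_decay a n) powr \<rho>)"

lemma norm_eq_exp_log_decay:
  assumes "n > 0" "a n \<noteq> 0"
  shows "norm (a n) = exp (- (real n * log_decay a n))"
  using assms by (simp add: log_decay_def ln_div ln_root)

section \<open>Entire power series: Cauchy's inequality and decay of the coefficients\<close>

context
  fixes f :: "complex \<Rightarrow> complex" and a :: "nat \<Rightarrow> complex"
  assumes sums: "\<And>z. (\<lambda>n. a n * z ^ n) sums f z"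
begin

text \<open>Serves to identify \<open>a n\<close> with \<open>(deriv ^^ n) f 0 / fact n\<close>,
  which Cauchy's inequality estimates.\<close>

lemma fps_expansion: "f has_fps_expansion Abs_fps a"
proof -
  have "fps_conv_radius (Abs_fps a) = \<infinity>"
    unfolding fps_conv_radius_def
    by (rule conv_radius_inftyI'') (use sums in \<open>auto simp: sums_iff\<close>)
  moreover have "eval_fps (Abs_fps a) z = f z" for z
    using sums[of z] by (simp add: eval_fps_def sums_iff)
  ultimately show ?thesis
    by (simp add: has_fps_expansion_def)
qed

lemma holomorphic: "f holomorphic_on A"
proof -
  have "f holomorphic_on ball 0 r" for r
    by (rule power_series_holomorphic[of _ _ a]) (use sums in simp)
  then have "f field_differentiable at z" for z
    by (rule holomorphic_on_imp_differentiable_at[of _ "ball 0 (norm z + 1)"]) auto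
  then show ?thesis
    by (meson field_differentiable_at_within holomorphic_on_def)
qed

text \<open>Compactness of the disc bounds the values of \<open>norm (f z)\<close>, so that their
  real supremum is an upper bound.\<close>

lemma norm_le_max_modulus: "norm z \<le> r \<Longrightarrow> norm (f z) \<le> max_modulus f r"
proof -
  assume "norm z \<le> r"
  have "compact ((\<lambda>z. norm (f z)) ` cball 0 r)"
    by (intro compact_continuous_image continuous_intros holomorphic_on_imp_continuous_on
        holomorphic) auto
  then show ?thesis
    unfolding max_modulus_def using \<open>norm z \<le> r\<close>
    by (intro cSUP_upper) (auto intro: bounded_imp_bdd_above compact_imp_bounded)
qed

lemma norm_coeff_le:
  assumes "r > 0"
  shows "norm (a n) \<le> max_modulus f r / r ^ n"
proof -
  have "norm ((deriv ^^ n) f 0) \<le> fact n * max_modulus f r / r ^ n"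
    by (rule Cauchy_inequality)
      (use assms in \<open>auto intro!: holomorphic holomorphic_on_imp_continuous_on
         norm_le_max_modulus\<close>)
  then have "norm ((deriv ^^ n) f 0) / fact n \<le> max_modulus f r / r ^ n"
    by (simp add: field_simps)
  moreover have "a n = (deriv ^^ n) f 0 / fact n"
    using fps_nth_fps_expansion[OF fps_expansion, of n] by simp
  ultimately show ?thesis
    by (simp only: norm_divide norm_fact)
qed

text \<open>Convergence at the larger radius \<open>r + 1\<close> gives absolute convergence at
  \<open>r\<close>.\<close>

lemma summable_coeff: "summable (\<lambda>n. norm (a n) * r ^ n)" if "r \<ge> 0" for r
proof -
  have "summable (\<lambda>n. norm (a n * of_real r ^ n))"
  proof (rule powser_insidea)
    show "summable (\<lambda>n. a n * of_real (r + 1) ^ n)"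
      using sums sums_summable by blast
    show "norm (of_real r :: complex) < norm (of_real (r + 1) :: complex)"
      unfolding norm_of_real using that by simp
  qed
  then show ?thesis
    using that by (simp add: norm_mult norm_power)
qed

text \<open>For \<open>n > 0\<close> and \<open>a n \<noteq> 0\<close>, the null sequence
  \<open>norm (a n) * exp K ^ n\<close> equals \<open>exp (n * (K - log_decay a n))\<close>. Large
  \<open>K\<close> will keep the iterated logarithms in their positive range.\<close>

lemma eventually_log_decay_ge:
  "\<forall>\<^sub>F n in sequentially. a n \<noteq> 0 \<longrightarrow> K \<le> log_decay a n"
proof -
  have "(\<lambda>n. norm (a n) * exp K ^ n) \<longlonglongrightarrow> 0"
    by (intro summable_LIMSEQ_zero summable_coeff) auto
  then have "\<forall>\<^sub>F n in sequentially. norm (a n) * exp K ^ n < 1"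
    by (rule order_tendstoD) simp
  then show ?thesis
    using eventually_gt_at_top[of 0]
  proof eventually_elim
    case (elim n)
    show ?case
    proof
      assume "a n \<noteq> 0"
      then have "exp (real n * (K - log_decay a n)) < 1"
        using elim norm_eq_exp_log_decay[of n a]
        by (simp add: algebra_simps exp_diff exp_minus field_simps flip: exp_of_nat_mult exp_of_nat2_mult)
      then show "K \<le> log_decay a n"
        using elim by (simp add: mult_less_0_iff)
    qed
  qed
qed

section \<open>From growth of the maximum modulus to coefficient decay\<close>

text \<open>At radius \<open>exp (exp (t n))\<close>, Cauchy's inequality gives
  \<open>\<delta> * exp (t n) \<le> log_decay a n\<close>. Taking logarithms costs only the constant
  \<open>ln \<delta>\<close>, which is negligible against \<open>t n\<close>.\<close>

lemma double_log_decay_if_growth: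
  assumes "0 < c" "c < c'" "0 < \<rho>" and growth: "double_log_growth f c \<rho>"
  shows "double_log_decay a c' \<rho>"
proof -
  \<comment> \<open>Two gaps are needed: \<open>c < c\<^sub>1\<close> makes \<delta> positive, and
    \<open>c\<^sub>1 < c'\<close> leaves room for \<open>ln \<delta>\<close>.\<close>
  define c\<^sub>1 where "c\<^sub>1 = (c + c') / 2"
  define \<delta> where "\<delta> = 1 - c / c\<^sub>1"
  \<comment> \<open>Chosen so that \<open>c\<^sub>1 * t n powr \<rho> = n\<close> and
    \<open>(q * t n) powr \<rho> = n / c'\<close>.\<close>
  define q where "q = (c\<^sub>1 / c') powr (1 / \<rho>)"
  define t where "t n = (real n / c\<^sub>1) powr (1 / \<rho>)" for n
  have c\<^sub>1: "c < c\<^sub>1" "c\<^sub>1 < c'" "0 < c\<^sub>1"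
    using assms by (auto simp: c\<^sub>1_def)
  have "\<delta> > 0"
    using c\<^sub>1 by (simp add: \<delta>_def)
  have "q < 1" "0 < q"
    using c\<^sub>1 assms powr_less_mono2[of "1 / \<rho>" "c\<^sub>1 / c'" 1] by (auto simp: q_def)
  have t_powr: "t n powr \<rho> = real n / c\<^sub>1" for n
    using assms c\<^sub>1 by (simp add: t_def powr_powr)
  have q_powr: "q powr \<rho> = c\<^sub>1 / c'"
    using assms c\<^sub>1 by (simp add: q_def powr_powr)
  have t_lim: "filterlim t at_top sequentially"
    unfolding t_def using assms c\<^sub>1
    by (auto intro!: filterlim_compose[OF real_powr_at_top] filterlim_at_top_mult_tendsto_pos[OF tendsto_const]
        filterlim_real_sequentially simp: divide_inverse)
  have "filterlim (\<lambda>n. exp (exp (t n))) at_top sequentially"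
    by (intro filterlim_compose[OF exp_at_top] t_lim)
  with growth have "\<forall>\<^sub>F n in sequentially. max_modulus f (exp (exp (t n)))
      \<le> exp (exp (t n)) powr (c * ln (ln (exp (exp (t n)))) powr \<rho>)"
    unfolding double_log_growth_def by (rule eventually_compose_filterlim)
  \<comment> \<open>This threshold is equivalent to
    \<open>q * t n \<le> ln \<delta> + t n\<close>.\<close>
  moreover have "\<forall>\<^sub>F n in sequentially. - ln \<delta> / (1 - q) \<le> t n"
    using t_lim by (auto simp: filterlim_at_top)
  ultimately have "\<forall>\<^sub>F n in sequentially. a n \<noteq> 0 \<longrightarrow> real n \<le> c' * ln (log_decay a n) powr \<rho>"
    using eventually_gt_at_top[of 0]
  proof eventually_elim
    case (elim n)
    show ?case
    proof
      assume "a n \<noteq> 0"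
      have "exp (- (real n * log_decay a n)) \<le> max_modulus f (exp (exp (t n))) / exp (exp (t n)) ^ n"
        using norm_coeff_le[of "exp (exp (t n))" n] norm_eq_exp_log_decay[of n a] elim \<open>a n \<noteq> 0\<close>
        by simp
      also have "\<dots> \<le> exp (exp (t n)) powr (c * t n powr \<rho>) / exp (exp (t n)) ^ n"
        using elim by (intro divide_right_mono) auto
      \<comment> \<open>The exponent is \<open>exp (t n) * (c * n / c\<^sub>1 - n)\<close>, and
        \<open>c / c\<^sub>1 - 1 = -\<delta>\<close>.\<close>
      also have "\<dots> = exp (- (real n * (\<delta> * exp (t n))))"
        unfolding t_powr by (simp add: powr_def exp_diff[symmetric] \<delta>_def algebra_simps
            flip: exp_of_nat_mult)
      finally have decay: "\<delta> * exp (t n) \<le> log_decay a n"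
        using elim by simp
      have "q * t n \<le> ln \<delta> + t n"
        using elim \<open>q < 1\<close> by (simp add: field_simps)
      also have "\<dots> = ln (\<delta> * exp (t n))"
        using \<open>\<delta> > 0\<close> by (simp add: ln_mult)
      also have "\<dots> \<le> ln (log_decay a n)"
        using decay \<open>\<delta> > 0\<close> by (subst ln_le_cancel_iff) (auto intro: less_le_trans[OF _ decay])
      finally have "(q * t n) powr \<rho> \<le> ln (log_decay a n) powr \<rho>"
        using assms \<open>0 < q\<close> by (intro powr_mono2) (auto simp: t_def)
      moreover have "(q * t n) powr \<rho> = real n / c'"
        using c\<^sub>1 \<open>0 < q\<close> by (simp add: powr_mult t_powr q_powr t_def[symmetric])
      ultimately show "real n \<le> c' * ln (log_decay a n) powr \<rho>"
        using c\<^sub>1 by (simp add: field_simps)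
    qed
  qed
  then show ?thesis
    by (simp add: double_log_decay_def)
qed

section \<open>From coefficient decay to growth of the maximum modulus\<close>

text \<open>A bound at the doubled radius leaves a factor \<open>(1 / 2) ^ n\<close> at radius
  \<open>r\<close>, so a geometric series dominates.\<close>

lemma max_modulus_le:
  assumes "0 \<le> r" and bound: "\<And>n. norm (a n) * (2 * r) ^ n \<le> B"
  shows "max_modulus f r \<le> 2 * B"
  unfolding max_modulus_def
proof (rule cSUP_least)
  fix z :: complex
  assume "z \<in> cball 0 r"
  have geom: "(\<lambda>n. B * (1 / 2) ^ n) sums (2 * B)"
    using sums_mult[OF geometric_sums[of "1 / 2 :: real"], of B] by (simp add: mult.commute)
  have term_le: "norm (a n * z ^ n) \<le> B * (1 / 2) ^ n" for n
  proof -
    have "norm (a n * z ^ n) \<le> norm (a n) * r ^ n"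
      using \<open>z \<in> cball 0 r\<close> by (auto simp: norm_mult norm_power intro!: mult_left_mono power_mono)
    also have "\<dots> = norm (a n) * (2 * r) ^ n * (1 / 2) ^ n"
      by (simp add: power_mult_distrib power_divide)
    also have "\<dots> \<le> B * (1 / 2) ^ n"
      by (intro mult_right_mono bound) auto
    finally show ?thesis .
  qed
  show "norm (f z) \<le> 2 * B"
    using norm_suminf_le[of "\<lambda>n. a n * z ^ n" "\<lambda>n. B * (1 / 2) ^ n"] term_le geom sums[of z]
    by (simp add: sums_iff)
qed (use assms in auto)

lemma double_log_growth_if_decay:
  assumes "0 < c" "c < c'" "0 < \<rho>" and decay: "double_log_decay a c \<rho>"
  shows "double_log_growth f c' \<rho>"
proof -
  define c\<^sub>1 where "c\<^sub>1 = (c + c') / 2"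
  \<comment> \<open>For \<open>n > c\<^sub>1 * L powr \<rho>\<close>, with
    \<open>L = ln (ln r)\<close>, decay will give \<open>ln (log_decay a n) > q * L\<close>. The
    excess \<open>(q - 1) * L\<close> pays for the doubled radius.\<close>
  define q where "q = (c\<^sub>1 / c) powr (1 / \<rho>)"
  have c\<^sub>1: "c < c\<^sub>1" "c\<^sub>1 < c'" "0 < c\<^sub>1"
    using assms by (auto simp: c\<^sub>1_def)
  have "1 < q"
    using c\<^sub>1 assms powr_less_mono2[of "1 / \<rho>" 1 "c\<^sub>1 / c"] by (auto simp: q_def)
  have q_powr: "q powr \<rho> = c\<^sub>1 / c"
    using assms c\<^sub>1 by (simp add: q_def powr_powr)
  have "\<forall>\<^sub>F n in sequentially. a n \<noteq> 0 \<longrightarrow>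
      real n \<le> c * ln (log_decay a n) powr \<rho> \<and> exp 1 \<le> log_decay a n"
    using decay[unfolded double_log_decay_def] eventually_log_decay_ge[of "exp 1"]
    by eventually_elim auto
  then obtain N where N: "\<And>n. n \<ge> N \<Longrightarrow> a n \<noteq> 0 \<Longrightarrow>
      real n \<le> c * ln (log_decay a n) powr \<rho> \<and> exp 1 \<le> log_decay a n"
    by (auto simp: eventually_at_top_linorder)
  obtain C where C: "C \<ge> 1" "\<And>n. norm (a n) \<le> C"
  proof -
    have "(\<lambda>n. norm (a n) * 1 ^ n) \<longlonglongrightarrow> 0"
      by (intro summable_LIMSEQ_zero summable_coeff) simp
    then have "Bseq (\<lambda>n. norm (a n))"
      by (intro convergent_imp_Bseq convergentI) simp
    then obtain K where "\<And>n. norm (a n) \<le> K"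
      by (auto simp: Bseq_def)
    then show thesis
      by (intro that[of "max 1 K"]) (auto simp: le_max_iff_disj)
  qed
  have ln_lim: "filterlim (\<lambda>r :: real. ln (ln r)) at_top at_top"
    by (intro filterlim_compose[OF ln_at_top] ln_at_top)
  have "filterlim (\<lambda>r :: real. c\<^sub>1 * ln (ln r) powr \<rho>) at_top at_top"
    using assms c\<^sub>1
    by (intro filterlim_tendsto_pos_mult_at_top[OF tendsto_const] filterlim_compose[OF real_powr_at_top]
        ln_lim) auto
  \<comment> \<open>The three thresholds in turn put the cutoff beyond \<open>N\<close>, give
    \<open>ln 2 + L \<le> q * L\<close>, and let \<open>(c' - c\<^sub>1) * ln r\<close> absorb the
    constants.\<close>
  then have "\<forall>\<^sub>F r in at_top. max 1 (real N) \<le> c\<^sub>1 * ln (ln r) powr \<rho>"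
    unfolding filterlim_at_top by blast
  moreover have "\<forall>\<^sub>F r :: real in at_top. max 1 (ln 2 / (q - 1)) \<le> ln (ln r)"
    using ln_lim unfolding filterlim_at_top by blast
  moreover have "\<forall>\<^sub>F r :: real in at_top. max 1 ((ln (2 * C) + c\<^sub>1 * ln 2) / (c' - c\<^sub>1)) \<le> ln r"
    using ln_at_top unfolding filterlim_at_top by blast
  ultimately show ?thesis
    unfolding double_log_growth_def using eventually_gt_at_top[of 1]
  proof eventually_elim
    case (elim r)
    define l where "l = ln r"
    define L where "L = ln l"
    define n\<^sub>0 where "n\<^sub>0 = c\<^sub>1 * L powr \<rho>"
    have l: "l \<ge> 1" "exp L = l" "exp l = r"
      using elim by (auto simp: l_def L_def)
    have L: "L \<ge> 1"
      using elim by (simp add: L_def l_def)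
    have n\<^sub>0: "real N \<le> n\<^sub>0" "0 \<le> n\<^sub>0"
      using elim c\<^sub>1 by (auto simp: n\<^sub>0_def L_def l_def)
    have r2: "2 * r = exp (ln 2 + l)"
      using l by (simp add: exp_add)
    have ln2: "0 < ln (2 :: real)" "ln (2 :: real) \<le> 1"
      using ln_le_minus_one[of "2 :: real"] by auto
    have "norm (a n) * (2 * r) ^ n \<le> C * exp (n\<^sub>0 * (ln 2 + l))" for n
    proof (cases "real n \<le> n\<^sub>0")
      case True
      then have "(2 * r) ^ n \<le> exp (n\<^sub>0 * (ln 2 + l))"
        using l ln2 unfolding r2 by (auto simp flip: exp_of_nat_mult intro!: mult_right_mono)
      then show ?thesis
        using C(2)[of n] C(1) elim by (intro mult_mono) auto
    next
      case False
      have "norm (a n) * (2 * r) ^ n \<le> 1"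
      proof (cases "a n = 0")
        case nz: False
        have n: "real n \<le> c * ln (log_decay a n) powr \<rho>" "exp 1 \<le> log_decay a n" "n > 0"
          using N[of n] nz False n\<^sub>0 by auto
        have pos: "log_decay a n > 0" "ln (log_decay a n) \<ge> 1"
          using n(2) less_le_trans[of 0 "exp 1" "log_decay a n"] by (auto simp: ln_ge_iff)
        have "(q * L) powr \<rho> < ln (log_decay a n) powr \<rho>"
          using n False assms L \<open>1 < q\<close> by (simp add: powr_mult q_powr n\<^sub>0_def field_simps)
        then have "q * L < ln (log_decay a n)"
          by (rule powr_less_cancel2[rotated -1]) 
            (use assms L \<open>1 < q\<close> less_le_trans[OF zero_less_one pos(2)] in simp_all)
        moreover have "ln 2 + L \<le> q * L"
          using elim \<open>1 < q\<close> by (simp add: L_def l_def field_simps)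
        ultimately have "exp (ln 2 + L) < exp (ln (log_decay a n))"
          by simp
        \<comment> \<open>The left side above is \<open>2 * l\<close>, and
          \<open>ln 2 \<le> 1 \<le> l\<close>.\<close>
        then have "ln 2 + l \<le> log_decay a n"
          using pos l ln2 by (simp add: exp_add)
        then have "real n * (ln 2 + l) \<le> real n * log_decay a n"
          by (intro mult_left_mono) auto
        then show ?thesis
          using norm_eq_exp_log_decay[of n a] n nz unfolding r2
          by (simp flip: exp_of_nat_mult exp_add)
      qed auto
      moreover have "1 * 1 \<le> C * exp (n\<^sub>0 * (ln 2 + l))"
        using C(1) n\<^sub>0 l ln2 by (intro mult_mono) auto
      ultimately show ?thesis
        by linarith
    qed
    then have "max_modulus f r \<le> 2 * (C * exp (n\<^sub>0 * (ln 2 + l)))"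
      using elim by (intro max_modulus_le) auto
    also have "\<dots> = exp (ln (2 * C) + n\<^sub>0 * (ln 2 + l))"
      using C(1) by (simp add: exp_add ln_mult)
    \<comment> \<open>Since \<open>L powr \<rho> \<ge> 1\<close>, it may multiply
      \<open>ln (2 * C)\<close>; the gap \<open>(c' - c\<^sub>1) * l\<close> then covers
      \<open>ln (2 * C) + c\<^sub>1 * ln 2\<close>.\<close>
    also have "ln (2 * C) + n\<^sub>0 * (ln 2 + l) \<le> c' * L powr \<rho> * l"
    proof -
      have "ln (2 * C) * 1 \<le> ln (2 * C) * L powr \<rho>"
        using C(1) L assms by (intro mult_left_mono) (auto simp: ge_one_powr_ge_zero)
      moreover have "L powr \<rho> * (ln (2 * C) + c\<^sub>1 * ln 2) \<le> L powr \<rho> * ((c' - c\<^sub>1) * l)"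
        using elim c\<^sub>1 by (intro mult_left_mono) (auto simp: l_def field_simps)
      ultimately show ?thesis
        by (simp add: n\<^sub>0_def algebra_simps)
    qed
    also have "exp (c' * L powr \<rho> * l) = r powr (c' * ln (ln r) powr \<rho>)"
      using elim by (simp add: powr_def L_def l_def)
    finally show ?case
      by simp
  qed
qed

section \<open>The formula for the double logarithmic order\<close>

text \<open>Ensures that every real above the limit superior is positive, as an admissible exponent
  must be.\<close>

lemma limsup_order_term_nonneg: "0 \<le> limsup (\<lambda>n. ereal (double_log_order_term a n))"
proof (rule le_Limsup)
  show "\<forall>\<^sub>F n in sequentially. 0 \<le> ereal (double_log_order_term a n)"
    using eventually_log_decay_ge[of "exp 1"] eventually_gt_at_top[of 0]
  proof eventually_elim
    case (elim n)
    have "0 \<le> ln (ln (log_decay a n))" if "a n \<noteq> 0"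
      using elim that less_le_trans[of 0 "exp 1" "log_decay a n"] by (auto simp: ln_ge_iff)
    then show ?case
      using elim by (auto simp: double_log_order_term_def log_decay_def intro!: divide_nonneg_nonneg)
  qed
qed simp

lemma double_log_order_eq:
  "double_log_order f = limsup (\<lambda>n. ereal (double_log_order_term a n))"
proof (rule antisym)
  show "double_log_order f \<le> limsup (\<lambda>n. ereal (double_log_order_term a n))"
  proof (rule dense_ge)
    fix x
    assume "limsup (\<lambda>n. ereal (double_log_order_term a n)) < x"
    then obtain y where y: "limsup (\<lambda>n. ereal (double_log_order_term a n)) < ereal y" "ereal y < x"
      using ereal_dense2 by blast
    \<comment> \<open>Two reals are inserted: \<open>s\<close> gives decay with constant 1, hence
      growth with constant 2, and the larger exponent \<open>y\<close> absorbs that 2.\<close>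
    then obtain s where s: "limsup (\<lambda>n. ereal (double_log_order_term a n)) < ereal s" "s < y"
      using ereal_dense2[OF y(1)] by auto
    have "0 < s"
      using limsup_order_term_nonneg s(1) by (metis ereal_less(2) le_less_trans)
    have "double_log_decay a 1 s"
      unfolding double_log_decay_def
      \<comment> \<open>The bound \<open>exp (exp 1)\<close> makes the denominator
        \<open>ln (ln (log_decay a n))\<close> at least 1, so it can be multiplied out.\<close>
      using Limsup_lessD[OF s(1)] eventually_log_decay_ge[of "exp (exp 1)"]
        eventually_gt_at_top[of 0]
    proof eventually_elim
      case (elim n)
      show ?case
      proof
        assume "a n \<noteq> 0"
        then have "exp (exp 1) \<le> log_decay a n"
          using elim by simp
        then have b: "exp 1 \<le> ln (log_decay a n)"
          by (subst ln_ge_iff) (auto intro: less_le_trans[of 0 "exp (exp 1)"])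
        then have pos: "0 < ln (log_decay a n)"
          by (rule less_le_trans[rotated]) simp
        then have "1 \<le> ln (ln (log_decay a n))"
          using b by (simp add: ln_ge_iff)
        then have "ln (real n) < s * ln (ln (log_decay a n))"
          using elim \<open>a n \<noteq> 0\<close> by (simp add: double_log_order_term_def log_decay_def field_simps)
        then have "exp (ln (real n)) \<le> exp (s * ln (ln (log_decay a n)))"
          by simp
        then show "real n \<le> 1 * ln (log_decay a n) powr s"
          using elim pos by (simp add: powr_def)
      qed
    qed
    then have "double_log_growth f 2 s"
      using \<open>0 < s\<close> by (intro double_log_growth_if_decay[of 1]) auto
    \<comment> \<open>From this point on \<open>2 \<le> ln (ln r) powr (y - s)\<close>.\<close>
    moreover have "\<forall>\<^sub>F r :: real in at_top. max 1 (2 powr (1 / (y - s))) \<le> ln (ln r)"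
      using filterlim_compose[OF ln_at_top ln_at_top] unfolding filterlim_at_top by blast
    ultimately have "\<forall>\<^sub>F r in at_top. max_modulus f r \<le> r powr (ln (ln r) powr y)"
      unfolding double_log_growth_def using eventually_gt_at_top[of 1]
    proof eventually_elim
      case (elim r)
      have "2 = (2 powr (1 / (y - s))) powr (y - s)"
        using s by (simp add: powr_powr)
      also have "\<dots> \<le> ln (ln r) powr (y - s)"
        using elim s by (intro powr_mono2) auto
      finally have "2 * ln (ln r) powr s \<le> ln (ln r) powr (y - s) * ln (ln r) powr s"
        by (intro mult_right_mono) auto
      also have "\<dots> = ln (ln r) powr y"
        by (simp flip: powr_add)
      finally show ?case
        using elim by (auto intro!: order.trans[OF elim(1)] powr_mono)
    qed
    then have "double_log_order f \<le> ereal y"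
      unfolding double_log_order_def using \<open>0 < s\<close> s by (intro Inf_lower) auto
    then show "double_log_order f \<le> x"
      using y by simp
  qed
next
  show "limsup (\<lambda>n. ereal (double_log_order_term a n)) \<le> double_log_order f"
    unfolding double_log_order_def
  proof (rule Inf_greatest, safe)
    fix \<rho> :: real
    assume "0 < \<rho>" and "\<forall>\<^sub>F r in at_top. max_modulus f r \<le> r powr (ln (ln r) powr \<rho>)"
    then have decay: "double_log_decay a 2 \<rho>"
      by (intro double_log_decay_if_growth[of 1]) (auto simp: double_log_growth_def)
    show "limsup (\<lambda>n. ereal (double_log_order_term a n)) \<le> ereal \<rho>"
    proof (rule ereal_le_epsilon2)
      fix e :: real
      assume "0 < e"
      \<comment> \<open>Makes \<open>ln 2 \<le> e * ln (ln (log_decay a n))\<close>, absorbing the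
        constant 2; the 1 keeps the denominator positive.\<close>
      define K where "K = max 1 (ln 2 / e)"
      have "\<forall>\<^sub>F n in sequentially. ereal (double_log_order_term a n) \<le> ereal \<rho> + ereal e"
        using decay[unfolded double_log_decay_def] eventually_log_decay_ge[of "exp (exp K)"]
          eventually_gt_at_top[of 0]
      proof eventually_elim
        case (elim n)
        have "double_log_order_term a n \<le> \<rho> + e" if nz: "a n \<noteq> 0"
        proof -
          have "exp (exp K) \<le> log_decay a n"
            using elim nz by simp
          then have b: "exp K \<le> ln (log_decay a n)"
            by (subst ln_ge_iff) (auto intro: less_le_trans[of 0 "exp (exp K)"])
          then have pos: "0 < ln (log_decay a n)"
            by (rule less_le_trans[rotated]) simp
          then have K: "K \<le> ln (ln (log_decay a n))"
            using b by (simp add: ln_ge_iff)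
          have "ln (real n) \<le> ln (2 * ln (log_decay a n) powr \<rho>)"
            using elim nz pos by (subst ln_le_cancel_iff) auto
          also have "\<dots> = ln 2 + \<rho> * ln (ln (log_decay a n))"
            using pos by (simp add: ln_mult ln_powr)
          also have "ln 2 \<le> e * ln (ln (log_decay a n))"
            using K \<open>0 < e\<close> by (simp add: K_def field_simps)
          finally have "ln (real n) \<le> (\<rho> + e) * ln (ln (log_decay a n))"
            by (simp add: algebra_simps)
          moreover have "0 < ln (ln (log_decay a n))"
            using K by (simp add: K_def)
          ultimately show ?thesis
            using nz by (simp add: double_log_order_term_def log_decay_def field_simps)
        qed
        moreover have "double_log_order_term a n \<le> \<rho> + e" if "a n = 0"
          using that \<open>0 < \<rho>\<close> \<open>0 < e\<close> by (simp add: double_log_order_term_def)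
        ultimately show ?case
          by auto
      qed
      then show "limsup (\<lambda>n. ereal (double_log_order_term a n)) \<le> ereal \<rho> + ereal e"
        by (rule Limsup_bounded)
    qed
  qed
qed

section \<open>The formula for the double logarithmic type\<close>

text \<open>Eventually the denominator is positive and can be cleared; where \<open>a n = 0\<close>
  the term is 0, which is below \<open>c\<close>.\<close>

lemma double_log_decay_iff_type_term:
  assumes "0 < c"
  shows "double_log_decay a c \<rho> \<longleftrightarrow>
    (\<forall>\<^sub>F n in sequentially. double_log_type_term \<rho> a n \<le> c)"
  unfolding double_log_decay_def
proof (rule eventually_cong)
  show "\<forall>\<^sub>F n in sequentially. a n \<noteq> 0 \<longrightarrow> exp 1 \<le> log_decay a n"
    by (rule eventually_log_decay_ge)
next
  fix n
  assume ge: "a n \<noteq> 0 \<longrightarrow> exp 1 \<le> log_decay a n"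
  have "0 < ln (log_decay a n) powr \<rho>" if "a n \<noteq> 0"
    using ge that less_le_trans[of 0 "exp 1" "log_decay a n"] ln_ge_iff[of "log_decay a n" 1]
    by auto
  then show "(a n \<noteq> 0 \<longrightarrow> real n \<le> c * ln (log_decay a n) powr \<rho>) \<longleftrightarrow>
      double_log_type_term \<rho> a n \<le> c"
    using assms by (auto simp: double_log_type_term_def log_decay_def field_simps)
qed

text \<open>With \<rho> fixed, admissible constants for growth and for decay agree up to an
  arbitrarily small increase, which infimum and limit superior do not see.\<close>

lemma double_log_type_eq:
  fixes \<rho> :: real
  assumes "double_log_order f = ereal \<rho>" "0 < \<rho>"
  shows "double_log_type f = limsup (\<lambda>n. ereal (double_log_type_term \<rho> a n))"
proof -
  have type: "double_log_type f = Inf (ereal ` {c. c > 0 \<and> double_log_growth f c \<rho>})"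
    by (simp add: double_log_type_def double_log_growth_def assms)
  have nonneg: "0 \<le> limsup (\<lambda>n. ereal (double_log_type_term \<rho> a n))"
    by (rule le_Limsup) (auto simp: double_log_type_term_def)
  show ?thesis
    unfolding type
  proof (rule antisym)
    show "Inf (ereal ` {c. c > 0 \<and> double_log_growth f c \<rho>})
        \<le> limsup (\<lambda>n. ereal (double_log_type_term \<rho> a n))"
    proof (rule dense_ge)
      fix x
      assume "limsup (\<lambda>n. ereal (double_log_type_term \<rho> a n)) < x"
      then obtain y where y: "limsup (\<lambda>n. ereal (double_log_type_term \<rho> a n)) < ereal y" "ereal y < x"
        using ereal_dense2 by blast
      \<comment> \<open>The gap from \<open>s\<close> to \<open>y\<close> is the increase of the
        constant in passing from decay to growth.\<close>
      then obtain s where s: "limsup (\<lambda>n. ereal (double_log_type_term \<rho> a n)) < ereal s" "s < y"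
        using ereal_dense2[OF y(1)] by auto
      have "0 < s"
        using nonneg s(1) by (metis ereal_less(2) le_less_trans)
      then have "double_log_decay a s \<rho>"
        using Limsup_lessD[OF s(1)]
        by (subst double_log_decay_iff_type_term) (auto elim: eventually_mono)
      then have "double_log_growth f y \<rho>"
        using \<open>0 < s\<close> s assms by (intro double_log_growth_if_decay[of s]) auto
      then have "Inf (ereal ` {c. c > 0 \<and> double_log_growth f c \<rho>}) \<le> ereal y"
        using \<open>0 < s\<close> s by (intro Inf_lower) auto
      then show "Inf (ereal ` {c. c > 0 \<and> double_log_growth f c \<rho>}) \<le> x"
        using y by simp
    qed
  next
    show "limsup (\<lambda>n. ereal (double_log_type_term \<rho> a n))
        \<le> Inf (ereal ` {c. c > 0 \<and> double_log_growth f c \<rho>})"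
    proof (rule Inf_greatest, safe)
      fix c :: real
      assume c: "0 < c" "double_log_growth f c \<rho>"
      show "limsup (\<lambda>n. ereal (double_log_type_term \<rho> a n)) \<le> ereal c"
      proof (rule ereal_le_epsilon2)
        fix e :: real
        assume "0 < e"
        then have "double_log_decay a (c + e) \<rho>"
          using c assms by (intro double_log_decay_if_growth[of c]) auto
        then show "limsup (\<lambda>n. ereal (double_log_type_term \<rho> a n)) \<le> ereal c + ereal e"
          using c \<open>0 < e\<close> by (intro Limsup_bounded) (simp add: double_log_decay_iff_type_term)
      qed
    qed
  qed
qed

end

theorem theorem6p2:
  fixes f :: "complex \<Rightarrow> complex" and a :: "nat \<Rightarrow> complex"
  assumes "transcendental_entire f"
    and "\<And>z. (\<lambda>n. a n * z ^ n) sums f z"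
    and "log_order f = 0"
  shows "double_log_order f = limsup (\<lambda>n. ereal (double_log_order_term a n)) \<and>
    (0 < double_log_order f \<and> double_log_order f < \<infinity> \<longrightarrow>
      double_log_type f =
        limsup (\<lambda>n. ereal (double_log_type_term (real_of_ereal (double_log_order f)) a n)))"
proof (intro conjI impI)
  show "double_log_order f = limsup (\<lambda>n. ereal (double_log_order_term a n))"
    by (rule double_log_order_eq[OF assms(2)])
next
  assume order: "0 < double_log_order f \<and> double_log_order f < \<infinity>"
  \<comment> \<open>Positivity and finiteness exclude both infinite values, so
    \<open>real_of_ereal\<close> is exact here.\<close>
  then obtain \<rho> where \<rho>: "double_log_order f = ereal \<rho>"
    by (cases "double_log_order f") auto
  with order have "0 < \<rho>"
    by simp
  with \<rho> show "double_log_type f =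
      limsup (\<lambda>n. ereal (double_log_type_term (real_of_ereal (double_log_order f)) a n))"
    using double_log_type_eq[OF assms(2) \<rho>] by simp
qed

end
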